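(* If $\mathrm{pen}=0$ and $\liminf_{x\to\infty}\big(p\,\mathrm{pen}_D(x)-\log x\big)=-\infty$, then for every $p\times p$ matrix $S$ that is positive semidefinite but not positive definite, the penalised likelihood estimate $\hat\Theta_{\mathrm{Pen}}$ does not exist.
   Context: Fix an integer $p\ge 1$. All matrices are real symmetric $p\times p$; $\Theta=(\theta_{ij})\succ 0$ means $\Theta$ is positive definite. The diagonal penalty $\mathrm{pen}_D:(0,\infty)\to\mathbb{R}$ is non-negative, non-decreasing and continuous, and $\mathrm{pen}:\mathbb{R}\to\mathbb{R}$ denotes the off-diagonal penalty. Define $$\mathrm{Pen}(\Theta)=\sum_{i=1}^p \mathrm{pen}_D(\theta_{ii})+\sum_{i<j}\mathrm{pen}(\theta_{ij}),\qquad l_{\mathrm{Pen}}(\Theta\mid S)=\log\det\Theta-\mathrm{tr}(S\Theta)-\mathrm{Pen}(\Theta),\quad \Theta\succ 0.$$ The penalised likelihood estimate is $\hat\Theta_{\mathrm{Pen}}=\mathrm{argmax}_{\Theta\succ 0}\, l_{\mathrm{Pen}}(\Theta\mid S)$; it is said to exist if the supremum of $l_{\mathrm{Pen}}(\cdot\mid S)$ over positive definite $\Theta$ is finite and attained. *)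

theory Defs
  imports "HOL-Analysis.Analysis"
begin

definition pos_semidef :: "real^'n^'n \<Rightarrow> bool" where
  "pos_semidef A \<longleftrightarrow> transpose A = A \<and> (\<forall>x. 0 \<le> x \<bullet> (A *v x))"

definition pos_def :: "real^'n^'n \<Rightarrow> bool" where
  "pos_def A \<longleftrightarrow> transpose A = A \<and> (\<forall>x. x \<noteq> 0 \<longrightarrow> 0 < x \<bullet> (A *v x))"

text \<open>
  The size of the matrices is the cardinality of the index type, which is linearly ordered so
  that the off-diagonal penalty can be summed over pairs of indices \<open>i < j\<close>. The diagonal
  penalty is a function on the positive reals; its values elsewhere are never used, as the
  diagonal entries of a positive definite matrix are positive.
\<close>

definition Pen ::
  "(real \<Rightarrow> real) \<Rightarrow> (real \<Rightarrow> real) \<Rightarrow>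
    real^('n::{finite,linorder})^('n::{finite,linorder}) \<Rightarrow> real" where
  "Pen pen_D pen \<Theta> =
     (\<Sum>i\<in>UNIV. pen_D (\<Theta> $ i $ i)) + (\<Sum>(i, j)\<in>{(i, j). i < j}. pen (\<Theta> $ i $ j))"

definition l_Pen ::
  "(real \<Rightarrow> real) \<Rightarrow> (real \<Rightarrow> real) \<Rightarrow>
    real^('n::{finite,linorder})^('n::{finite,linorder}) \<Rightarrow>
    real^('n::{finite,linorder})^('n::{finite,linorder}) \<Rightarrow> real"
  where
  "l_Pen pen_D pen S \<Theta> = ln (det \<Theta>) - trace (S ** \<Theta>) - Pen pen_D pen \<Theta>"

text \<open>
  The supremum is taken in the extended reals, where it always makes sense.
\<close>

definition penalised_estimate_exists ::
  "(real \<Rightarrow> real) \<Rightarrow> (real \<Rightarrow> real) \<Rightarrow>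
    real^('n::{finite,linorder})^('n::{finite,linorder}) \<Rightarrow> bool" where
  "penalised_estimate_exists pen_D pen S \<longleftrightarrow>
     (let s = (SUP \<Theta>\<in>{\<Theta>. pos_def \<Theta>}. ereal (l_Pen pen_D pen S \<Theta>))
      in \<bar>s\<bar> \<noteq> \<infinity> \<and> (\<exists>\<Theta>. pos_def \<Theta> \<and> ereal (l_Pen pen_D pen S \<Theta>) = s))"

end

theory Submission
  imports Defs
begin

text \<open>
  A singular positive semidefinite \<open>S\<close> has a unit vector \<open>v\<close> with \<open>v \<bullet> S v = 0\<close>. Along the ray
  \<open>\<Theta> = I + (x - 1) v v\<^sup>T\<close>, \<open>x \<ge> 1\<close>, the trace term is the constant \<open>tr S\<close>, the determinant is \<open>x\<close>,
  and the diagonal entries lie between \<open>1\<close> and \<open>x\<close>. Hence the penalised likelihood is at least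
  \<open>ln x - p pen_D(x) - tr S\<close>, which is unbounded above.
\<close>

text \<open>For a unit vector \<open>v\<close> this acts as \<open>1 + t\<close> along
  \<open>v\<close> and as the identity on the orthogonal complement.\<close>

definition rank_one_update :: "real \<Rightarrow> real^'n \<Rightarrow> real^'n^'n" where
  "rank_one_update t v = mat 1 + t *\<^sub>R (\<chi> i j. v $ i * v $ j)"

lemma rank_one_update_nth:
  "rank_one_update t v $ i $ j = (if i = j then 1 else 0) + t * (v $ i * v $ j)"
  by (simp add: rank_one_update_def mat_def)

lemma rank_one_update_mult_vec:
  "rank_one_update t v *v y = y + (t * (v \<bullet> y)) *\<^sub>R v"
  by (simp add: vec_eq_iff matrix_vector_mult_def rank_one_update_nth distrib_right sum.distrib
      inner_vec_def sum_distrib_left sum_distrib_right if_distrib[of "\<lambda>z. z * _"] cong: if_cong)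
     (simp add: algebra_simps)

lemma pos_def_rank_one_update:
  assumes "t \<ge> 0"
  shows "pos_def (rank_one_update t v)"
  unfolding pos_def_def
proof (intro conjI allI impI)
  show "transpose (rank_one_update t v) = rank_one_update t v"
    by (simp add: vec_eq_iff transpose_def rank_one_update_nth mult.commute)
  fix y :: "real^'a" assume "y \<noteq> 0"
  have "y \<bullet> (rank_one_update t v *v y) = y \<bullet> y + t * (v \<bullet> y)\<^sup>2"
    by (simp add: rank_one_update_mult_vec inner_add_right inner_commute power2_eq_square)
  with \<open>y \<noteq> 0\<close> assms show "0 < y \<bullet> (rank_one_update t v *v y)"
    by (simp add: add_pos_nonneg)
qed

text \<open>The rank-one part contributes the trace of the outer product of \<open>S *v v\<close>
  with \<open>v\<close>, which is the quadratic form of \<open>S\<close> at \<open>v\<close>. Where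
  that form vanishes, the trace term is constant in \<open>t\<close>.\<close>

lemma trace_mult_rank_one_update:
  "trace (S ** rank_one_update t v) = trace S + t * (v \<bullet> (S *v v))"
proof -
  have "S ** rank_one_update t v = S + t *\<^sub>R (\<chi> i j. (S *v v) $ i * v $ j)"
    by (simp add: vec_eq_iff matrix_matrix_mult_def matrix_vector_mult_def rank_one_update_nth
        distrib_left sum.distrib if_distrib[of "\<lambda>z. _ * z"] cong: if_cong)
       (simp add: sum_distrib_left sum_distrib_right mult_ac)
  then show ?thesis
    by (simp add: trace_def sum.distrib inner_vec_def sum_distrib_left mult_ac)
qed

text \<open>An orthogonal \<open>A\<close> taking a coordinate axis to \<open>v\<close> intertwines
  the update along that axis, which is diagonal, with the update along \<open>v\<close>; cancelling
  \<open>det A\<close> equates their determinants.\<close>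

lemma det_rank_one_update:
  fixes v :: "real^'n"
  assumes "norm v = 1"
  shows "det (rank_one_update t v) = 1 + t"
proof -
  fix k :: 'n
  obtain A :: "real^'n^'n" where A: "orthogonal_matrix A" "A *v axis k 1 = v"
    using orthogonal_matrix_exists_basis[OF assms] by blast
  define D :: "real^'n^'n" where "D = rank_one_update t (axis k 1)"
  have "det D = (\<Prod>i\<in>UNIV. D $ i $ i)"
    by (rule det_diagonal) (auto simp: D_def rank_one_update_nth axis_def)
  also have "\<dots> = (\<Prod>i\<in>UNIV. if i = k then 1 + t else 1)"
    by (rule prod.cong) (auto simp: D_def rank_one_update_nth axis_def)
  finally have detD: "det D = 1 + t" by simp
  have "(A ** D) *v y = (rank_one_update t v ** A) *v y" for y
  proof -
    \<comment> \<open>\<open>A\<close> preserves inner products and \<open>v\<close> is the image of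
      \<open>axis k 1\<close>.\<close>
    have "v \<bullet> (A *v y) = axis k 1 \<bullet> y"
      using A orthogonal_transformation_matrix[of "(*v) A"]
      by (metis matrix_of_matrix_vector_mul matrix_vector_mul_linear orthogonal_transformation_def)
    then show ?thesis
      by (simp add: D_def matrix_vector_mul_assoc[symmetric] rank_one_update_mult_vec
          matrix_vector_right_distrib matrix_vector_mult_scaleR A(2))
  qed
  then have "A ** D = rank_one_update t v ** A"
    by (simp add: matrix_eq)
  then have "det A * det D = det (rank_one_update t v) * det A"
    by (metis det_mul)
  moreover have "det A \<noteq> 0"
    using det_orthogonal_matrix[OF A(1)] by auto
  ultimately show ?thesis
    by (simp add: detD)
qed

lemma exists_unit_null_vector:
  fixes S :: "real^'n^'n"
  assumes "pos_semidef S" "\<not> pos_def S"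
  obtains v where "norm v = 1" "v \<bullet> (S *v v) = 0"
proof -
  \<comment> \<open>Symmetry is common to both notions, so definiteness can only fail at a nonzero
    \<open>u\<close> where the non-negative form is zero; normalising \<open>u\<close> keeps it
    zero.\<close>
  obtain u where u: "u \<noteq> 0" "u \<bullet> (S *v u) = 0"
    using assms unfolding pos_semidef_def pos_def_def by (metis order_less_le)
  show thesis
  proof
    show "norm (sgn u) = 1" using u by (simp add: norm_sgn)
    show "sgn u \<bullet> (S *v sgn u) = 0"
      using u by (simp add: sgn_div_norm matrix_vector_mult_scaleR)
  qed
qed

lemma l_Pen_rank_one_update_ge:
  fixes S :: "real^('n::{finite,linorder})^('n::{finite,linorder})"
  assumes "mono_on {0<..} pen_D" "norm v = 1" "v \<bullet> (S *v v) = 0" "x \<ge> 1"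
  shows "l_Pen pen_D (\<lambda>_. 0) S (rank_one_update (x - 1) v)
    \<ge> ln x - trace S - real CARD('n) * pen_D x"
proof -
  have "pen_D (rank_one_update (x - 1) v $ i $ i) \<le> pen_D x" for i
  proof -
    have "\<bar>v $ i\<bar> \<le> 1"
      using component_le_norm_cart[of v i] assms(2) by simp
    then have "v $ i * v $ i \<le> 1"
      by (simp add: abs_square_le_1 flip: power2_eq_square)
    then have "(x - 1) * (v $ i * v $ i) \<le> (x - 1) * 1"
      using assms(4) by (intro mult_left_mono) auto
    moreover have "0 \<le> (x - 1) * (v $ i * v $ i)"
      using assms(4) by simp
    ultimately show ?thesis
      \<comment> \<open>The entry is \<open>1 + (x - 1) * (v $ i)\<^sup>2\<close>: the lower bound
        on the second summand puts it in the domain \<open>{0<..}\<close> of monotonicity, the upper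
        bound puts it below \<open>x\<close>.\<close>
      using assms(4) by (intro mono_onD[OF assms(1)]) (auto simp: rank_one_update_nth intro: add_pos_nonneg)
  qed
  then have "(\<Sum>i\<in>UNIV. pen_D (rank_one_update (x - 1) v $ i $ i)) \<le> real CARD('n) * pen_D x"
    by (rule sum_bounded_above)
  then show ?thesis
    using assms by (simp add: l_Pen_def Pen_def det_rank_one_update trace_mult_rank_one_update)
qed

text \<open>Otherwise \<open>f\<close> would eventually be at least \<open>c\<close>, which would
  bound its lower limit below by a real number.\<close>

lemma frequently_less_if_Liminf_eq_MInfty:
  fixes f :: "'a \<Rightarrow> real"
  assumes "Liminf F (\<lambda>x. ereal (f x)) = - \<infinity>"
  shows "\<exists>\<^sub>F x in F. f x < c"
proof (rule ccontr)
  assume "\<not> (\<exists>\<^sub>F x in F. f x < c)"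
  then have "\<forall>\<^sub>F x in F. ereal c \<le> ereal (f x)"
    by (simp add: frequently_def not_less)
  then have "ereal c \<le> Liminf F (\<lambda>x. ereal (f x))"
    by (rule Liminf_bounded)
  with assms show False by simp
qed

theorem proposition4:
  fixes pen_D pen :: "real \<Rightarrow> real"
    and S :: "real^('n::{finite,linorder})^('n::{finite,linorder})"
  assumes pen_D_nonneg: "\<And>x. x > 0 \<Longrightarrow> pen_D x \<ge> 0"
    and pen_D_mono: "mono_on {0<..} pen_D"
    and pen_D_cont: "continuous_on {0<..} pen_D"
    and pen_zero: "pen = (\<lambda>_. 0)"
    and liminf: "Liminf at_top (\<lambda>x. ereal (real CARD('n::{finite,linorder}) * pen_D x - ln x)) = - \<infinity>"
    and S_psd: "pos_semidef S"
    and S_not_pd: "\<not> pos_def S"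
  shows "\<not> penalised_estimate_exists pen_D pen S"
proof
  assume "penalised_estimate_exists pen_D pen S"
  then obtain \<Theta> where max: "ereal (l_Pen pen_D pen S \<Theta>)
      = (SUP \<Theta>\<in>{\<Theta>. pos_def \<Theta>}. ereal (l_Pen pen_D pen S \<Theta>))"
    unfolding penalised_estimate_exists_def Let_def by blast
  \<comment> \<open>A maximiser makes the real number \<open>M\<close> an upper bound on the whole
    positive definite cone; the ray along \<open>v\<close> will exceed it.\<close>
  define M where "M = l_Pen pen_D pen S \<Theta>"
  have le_M: "l_Pen pen_D pen S \<Theta>' \<le> M" if "pos_def \<Theta>'" for \<Theta>'
    using SUP_upper[of \<Theta>' "{\<Theta>. pos_def \<Theta>}" "\<lambda>\<Theta>. ereal (l_Pen pen_D pen S \<Theta>)"] that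
    by (simp add: M_def flip: max)
  obtain v where v: "norm v = 1" "v \<bullet> (S *v v) = 0"
    using exists_unit_null_vector[OF S_psd S_not_pd] .
  \<comment> \<open>The threshold is what makes the lower bound
    \<open>ln x - trace S - real CARD('n) * pen_D x\<close> larger than \<open>M\<close>;
    \<open>1 \<le> x\<close> keeps the parameter \<open>x - 1\<close> of the update
    non-negative.\<close>
  have "\<exists>\<^sub>F x in at_top. real CARD('n) * pen_D x - ln x < - M - trace S \<and> 1 \<le> x"
    using frequently_less_if_Liminf_eq_MInfty[OF liminf] eventually_ge_at_top[of 1]
    by (rule frequently_eventually_frequently)
  then obtain x where x: "real CARD('n) * pen_D x - ln x < - M - trace S" "1 \<le> x"
    by (blast dest: frequently_ex)
  show False
    using l_Pen_rank_one_update_ge[OF pen_D_mono v x(2)] x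
      le_M[OF pos_def_rank_one_update[of "x - 1" v]]
    by (simp add: pen_zero)
qed

end
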